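(* Suppose that $f$ is $L_f$-smooth (not necessarily convex) and that the condition number of $A$ is $\kappa_A$. Let $x_0\in\mathbb{R}^n$, let $\{x_k\}$ be the iterate sequence generated by the inexact proximal point method described in the context, and let $x_1^\star$ be the exact solution of its first subproblem. Assume that $F(x_1^\star)-\inf_xF(x)\le\Delta'$ and $\delta_k=\frac{\sqrt{\Delta'/L_f}}{2k}$ for all $k\geq 1$. Then $$\min_{1\le k\le T}\mathrm{SubOpt}_{\mathsf{NC}}(x_k)\le\sqrt{\frac{5L_f\Delta'}{T}} .$$ In particular, if the initial point satisfies $x_0\in\mathrm{dom}\,F$ and $F(x_0)-\inf_xF(x)\le\Delta$ for some $\Delta>0$, then taking $\Delta'=\Delta$ yields $$\min_{1\le k\le T}\mathrm{SubOpt}_{\mathsf{NC}}(x_k)\le\sqrt{\frac{5L_f\Delta}{T}} .$$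
   Context: Problem: $\min_{x\in\mathbb{R}^n}F(x):=f(x)+h(Ax-b)$, where $f:\mathbb{R}^n\to\mathbb{R}$ is differentiable with $L_f$-Lipschitz gradient, $h:\mathbb{R}^m\to\mathbb{R}\cup\{+\infty\}$ is proper closed convex, and $A\in\mathbb{R}^{m\times n}$ has full row rank with condition number $\kappa_A$ (ratio of $\|A\|$ to its minimal singular value). Inexact proximal point method for non-convex problems: given $x_0$ and tolerances $\{\delta_k\}$, for $k=1,2,\dots,T$ compute (by an inner solver for strongly convex composite problems) a point $x_k$ with $\|x_k-x_k^\star\|\le\delta_k$, where $$x_k^\star:=\arg\min_x\left\{F(x)+L_f\|x-x_{k-1}\|^2\right\}.$$ Suboptimality measure: with $\mathrm{prox}_g(x)=\arg\min_u\{g(u)+\frac12\|x-u\|^2\}$, $$\mathrm{SubOpt}_{\mathsf{NC}}(x):=L_f\left\|x-\mathrm{prox}_{\frac1{2L_f}h(A\cdot-b)}\left(x-\frac1{2L_f}\nabla f(x)\right)\right\| .$$ *)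

theory Defs
  imports "HOL-Analysis.Analysis"
begin

(* Functions into R \<union> {+\<infinity>} are maps into ereal that never take the value -\<infinity>;
   the latter is part of properness. *)

definition proper_fun :: "('a \<Rightarrow> ereal) \<Rightarrow> bool" where
  "proper_fun h \<longleftrightarrow> (\<forall>y. h y \<noteq> -\<infinity>) \<and> (\<exists>y. h y < \<infinity>)"

(* HOL-Analysis' epigraph is for real-valued functions only. *)
definition ereal_epigraph :: "('a \<Rightarrow> ereal) \<Rightarrow> ('a \<times> real) set" where
  "ereal_epigraph h = {(y, t). h y \<le> ereal t}"

definition closed_fun :: "('a::topological_space \<Rightarrow> ereal) \<Rightarrow> bool" where
  "closed_fun h \<longleftrightarrow> closed (ereal_epigraph h)"

definition convex_fun :: "('a::real_vector \<Rightarrow> ereal) \<Rightarrow> bool" where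
  "convex_fun h \<longleftrightarrow> convex (ereal_epigraph h)"

definition eff_dom :: "('a \<Rightarrow> ereal) \<Rightarrow> 'a set" where
  "eff_dom F = {x. F x < \<infinity>}"

definition grad :: "('a::euclidean_space \<Rightarrow> real) \<Rightarrow> 'a \<Rightarrow> 'a" where
  "grad f x = (THE D. GDERIV f x :> D)"

lemma GDERIV_grad:
  fixes f :: "'a::euclidean_space \<Rightarrow> real"
  assumes "f differentiable at x"
  shows "GDERIV f x :> grad f x"
proof -
  obtain f' where f': "(f has_derivative f') (at x)"
    using assms unfolding differentiable_def by blast
  have lin: "linear f'"
    using f' by (rule has_derivative_linear)
  define D where "D = adjoint f' 1"
  have f'_eq: "f' = (\<lambda>u. u \<bullet> D)"
  proof
    fix u
    show "f' u = u \<bullet> D"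
      unfolding D_def using adjoint_works[OF lin, of u 1] by simp
  qed
  have D: "GDERIV f x :> D"
    using f' unfolding gderiv_def f'_eq .
  have uniq: "E = D" if "GDERIV f x :> E" for E
  proof -
    have "(\<lambda>u. u \<bullet> E) = (\<lambda>u. u \<bullet> D)"
      using that D has_derivative_unique unfolding gderiv_def by blast
    then have "u \<bullet> E = u \<bullet> D" for u
      by meson
    then show ?thesis
      using vector_eq_ldot by blast
  qed
  show ?thesis
    unfolding grad_def by (rule theI[where P = "\<lambda>D. GDERIV f x :> D", OF D uniq])
qed

definition smooth_with :: "real \<Rightarrow> ('a::euclidean_space \<Rightarrow> real) \<Rightarrow> bool" where
  "smooth_with L f \<longleftrightarrow> (\<forall>x. f differentiable at x) \<and> L-lipschitz_on UNIV (grad f)"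

definition singular_values :: "real ^ 'n ^ 'm \<Rightarrow> real set" where
  "singular_values A = {\<sigma>. \<sigma> \<ge> 0 \<and> (\<exists>u v. norm u = 1 \<and> norm v = 1 \<and>
     A *v v = \<sigma> *\<^sub>R u \<and> transpose A *v u = \<sigma> *\<^sub>R v)}"

definition condition_number :: "real ^ 'n ^ 'm \<Rightarrow> real" where
  "condition_number A = onorm ((*v) A) / Min (singular_values A)"

definition composite_obj ::
    "(real ^ 'n \<Rightarrow> real) \<Rightarrow> (real ^ 'm \<Rightarrow> ereal) \<Rightarrow> real ^ 'n ^ 'm \<Rightarrow> real ^ 'm \<Rightarrow> real ^ 'n \<Rightarrow> ereal" where
  "composite_obj f h A b x = ereal (f x) + h (A *v x - b)"

definition prox :: "('a::real_normed_vector \<Rightarrow> ereal) \<Rightarrow> 'a \<Rightarrow> 'a" where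
  "prox g x = (ARG_MIN (\<lambda>u. g u + ereal (1/2 * (norm (x - u))\<^sup>2)) u. True)"

definition exact_step :: "('a::real_normed_vector \<Rightarrow> ereal) \<Rightarrow> real \<Rightarrow> 'a \<Rightarrow> 'a" where
  "exact_step F L c = (ARG_MIN (\<lambda>x. F x + ereal (L * (norm (x - c))\<^sup>2)) x. True)"

(* The initial point is x 0; the conditions constrain x 1, ..., x T. *)
definition inexact_prox_point ::
    "('a::real_normed_vector \<Rightarrow> ereal) \<Rightarrow> real \<Rightarrow> (nat \<Rightarrow> real) \<Rightarrow> nat \<Rightarrow> (nat \<Rightarrow> 'a) \<Rightarrow> bool" where
  "inexact_prox_point F L \<delta> T x \<longleftrightarrow>
     (\<forall>k\<in>{1..T}. norm (x k - exact_step F L (x (k - 1))) \<le> \<delta> k)"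

definition subopt_nc ::
    "real \<Rightarrow> (real ^ 'n \<Rightarrow> real) \<Rightarrow> (real ^ 'm \<Rightarrow> ereal) \<Rightarrow> real ^ 'n ^ 'm \<Rightarrow> real ^ 'm \<Rightarrow> real ^ 'n \<Rightarrow> real" where
  "subopt_nc L f h A b x =
     L * norm (x - prox (\<lambda>u. ereal (1 / (2 * L)) * h (A *v u - b)) (x - (1 / (2 * L)) *\<^sub>R grad f x))"

end

(* Write y k for the exact proximal step from x (k - 1) and r k for the distance between x k and
   y (k + 1).  Comparing y (k + 1) with y k in the subproblem gives
   F (y (k + 1)) + L * r k ^ 2 <= F (y k) + L * \<delta> k ^ 2, which telescopes.  The first-order
   conditions of the subproblem and of the prox step taken at x k differ only by
   grad f (y (k + 1)) - grad f (x k), so monotonicity places the two minimizers within r k / 2 of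
   each other, whence SubOpt (x k) <= 3/2 * L * r k.  Since the sum of the 1 / k ^ 2 is at most 2,
   this yields the constant 9/4 * 3/2 <= 5. *)
theory Submission
  imports Defs
begin

section \<open>Composition of a closed proper convex function with an affine map\<close>

lemma ereal_epigraphI: "h y \<le> ereal t \<Longrightarrow> (y, t) \<in> ereal_epigraph h"
  by (simp add: ereal_epigraph_def)

lemma closed_fun_affine_compose:
  fixes A :: "real ^ 'n ^ 'm"
  assumes "closed_fun h"
  shows "closed_fun (\<lambda>u. h (A *v u - b))"
proof -
  have "continuous_on UNIV (\<lambda>p::(real^'n) \<times> real. (A *v fst p - b, snd p))"
    by (intro continuous_intros continuous_on_compose2[OF matrix_vector_mult_linear_continuous_on]) auto
  then have "closed ((\<lambda>p::(real^'n) \<times> real. (A *v fst p - b, snd p)) -` ereal_epigraph h)"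
    using assms by (intro closed_vimage) (auto simp: closed_fun_def)
  also have "(\<lambda>p::(real^'n) \<times> real. (A *v fst p - b, snd p)) -` ereal_epigraph h
      = ereal_epigraph (\<lambda>u. h (A *v u - b))"
    by (auto simp: ereal_epigraph_def)
  finally show ?thesis
    by (simp add: closed_fun_def)
qed

text \<open>Real upper bounds \<open>a\<close> and \<open>c\<close> replace the values of
  \<open>g\<close>, so convexity is used without multiplying infinite values.\<close>

lemma convex_funD:
  fixes g :: "'a::real_vector \<Rightarrow> ereal"
  assumes "convex_fun g" "g y \<le> ereal a" "g u \<le> ereal c" "0 \<le> t" "t \<le> 1"
  shows "g ((1 - t) *\<^sub>R y + t *\<^sub>R u) \<le> ereal ((1 - t) * a + t * c)"
proof -
  have "(1 - t) *\<^sub>R (y, a) + t *\<^sub>R (u, c) \<in> ereal_epigraph g"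
    using assms by (intro convexD) (auto simp: convex_fun_def ereal_epigraphI)
  then show ?thesis
    by (simp add: ereal_epigraph_def)
qed

lemma convex_fun_affine_compose:
  fixes A :: "real ^ 'n ^ 'm"
  assumes "convex_fun h"
  shows "convex_fun (\<lambda>u. h (A *v u - b))"
  unfolding convex_fun_def convex_alt
proof (intro ballI allI impI)
  fix p q :: "(real^'n) \<times> real" and t :: real
  assume pq: "p \<in> ereal_epigraph (\<lambda>u. h (A *v u - b))" "q \<in> ereal_epigraph (\<lambda>u. h (A *v u - b))"
    and t: "0 \<le> t \<and> t \<le> 1"
  obtain y a u c where [simp]: "p = (y, a)" "q = (u, c)"
    by (cases p, cases q)
  have "h ((1 - t) *\<^sub>R (A *v y - b) + t *\<^sub>R (A *v u - b)) \<le> ereal ((1 - t) * a + t * c)"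
    using pq t by (intro convex_funD[OF assms]) (auto simp: ereal_epigraph_def)
  also have "(1 - t) *\<^sub>R (A *v y - b) + t *\<^sub>R (A *v u - b) = A *v ((1 - t) *\<^sub>R y + t *\<^sub>R u) - b"
    by (simp add: matrix_vector_right_distrib matrix_vector_mult_scaleR algebra_simps)
  finally show "(1 - t) *\<^sub>R p + t *\<^sub>R q \<in> ereal_epigraph (\<lambda>u. h (A *v u - b))"
    by (simp add: ereal_epigraph_def)
qed

text \<open>Full row rank makes \<open>A\<close> surjective, so the affine map reaches a point where
  \<open>h\<close> is finite.\<close>

lemma proper_fun_affine_compose:
  fixes A :: "real ^ 'n ^ 'm"
  assumes "proper_fun h" "rank A = CARD('m)"
  shows "proper_fun (\<lambda>u. h (A *v u - b))"
proof -
  obtain y where y: "h y < \<infinity>"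
    using assms(1) by (auto simp: proper_fun_def)
  have "surj ((*v) A)"
    using assms(2) full_rank_surjective by blast
  then obtain u where "A *v u = y + b"
    by (metis surjD)
  with y have "h (A *v u - b) < \<infinity>"
    by simp
  then show ?thesis
    using assms(1) by (auto simp: proper_fun_def)
qed

section \<open>Existence of minimizers of coercive composite objectives\<close>

text \<open>The direct method, carried out in the epigraph: cutting it at a finite height leaves a
  compact set, on which the continuous height coordinate attains its minimum. Closedness of the
  epigraph takes the place of lower semicontinuity.\<close>

lemma coercive_minimizer_exists:
  fixes g :: "'a::euclidean_space \<Rightarrow> ereal"
  assumes g: "closed_fun g" "proper_fun g"
    and s: "continuous_on UNIV s"
    and c: "c > 0"
    and lb: "\<And>u. ereal (c * (norm (u - a))\<^sup>2 - C) \<le> ereal (s u) + g u"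
  shows "\<exists>v. \<forall>u. ereal (s v) + g v \<le> ereal (s u) + g u"
proof -
  let ?G = "\<lambda>u. ereal (s u) + g u"
  obtain u0 where "g u0 < \<infinity>" "g u0 \<noteq> -\<infinity>"
    using g(2) by (auto simp: proper_fun_def)
  then obtain M where M: "?G u0 = ereal M"
    by (cases "g u0") auto
  \<comment> \<open>Shearing by \<open>s\<close> exhibits the epigraph of the sum as a preimage of
    the epigraph of \<open>g\<close>.\<close>
  have "continuous_on UNIV (\<lambda>p::'a \<times> real. (fst p, snd p - s (fst p)))"
    by (intro continuous_intros continuous_on_compose2[OF s]) auto
  then have "closed ((\<lambda>p. (fst p, snd p - s (fst p))) -` ereal_epigraph g)"
    using g(1) by (intro closed_vimage) (auto simp: closed_fun_def)
  also have "(\<lambda>p. (fst p, snd p - s (fst p))) -` ereal_epigraph g = ereal_epigraph ?G"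
  proof -
    have "g u \<le> ereal (t - s u) \<longleftrightarrow> ?G u \<le> ereal t" for u t
      by (cases "g u") auto
    then show ?thesis
      by (auto simp: ereal_epigraph_def)
  qed
  finally have closed_G: "closed (ereal_epigraph ?G)" .
  \<comment> \<open>The height \<open>M\<close> is a finite value of the sum, so \<open>K\<close> is
    nonempty; the quadratic lower bound confines it to a ball times an interval.\<close>
  define K where "K = ereal_epigraph ?G \<inter> UNIV \<times> {..M}"
  have "K \<subseteq> cball a (sqrt ((M + C) / c)) \<times> {- C..M}"
  proof
    fix p assume p: "p \<in> K"
    obtain u t where [simp]: "p = (u, t)"
      by (cases p)
    have "?G u \<le> ereal t" and tM: "t \<le> M"
      using p by (auto simp: K_def ereal_epigraph_def)
    then have "ereal (c * (norm (u - a))\<^sup>2 - C) \<le> ereal t"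
      using lb[of u] order_trans by blast
    then have *: "c * (norm (u - a))\<^sup>2 - C \<le> t"
      by simp
    have "0 \<le> c * (norm (u - a))\<^sup>2"
      using c by simp
    then have "- C \<le> t"
      using * by linarith
    moreover have "(norm (u - a))\<^sup>2 \<le> (M + C) / c"
      using * tM c by (simp add: field_simps)
    then have "norm (u - a) \<le> sqrt ((M + C) / c)"
      by (rule real_le_rsqrt)
    ultimately show "p \<in> cball a (sqrt ((M + C) / c)) \<times> {- C..M}"
      using tM by (simp add: dist_norm norm_minus_commute)
  qed
  then have "bounded K"
    by (rule bounded_subset[rotated]) (intro bounded_Times bounded_cball bounded_closed_interval)
  moreover have "closed K"
    unfolding K_def by (intro closed_Int closed_G closed_Times) auto
  ultimately have "compact K"
    by (simp add: compact_eq_bounded_closed)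
  moreover have "(u0, M) \<in> K"
    using M by (simp add: K_def ereal_epigraph_def)
  ultimately obtain p where p: "p \<in> K" "\<And>q. q \<in> K \<Longrightarrow> snd p \<le> snd q"
    using continuous_attains_inf[of K snd] continuous_on_snd[OF continuous_on_id] by blast
  obtain v t where [simp]: "p = (v, t)"
    by (cases p)
  have vt: "?G v \<le> ereal t" "t \<le> M"
    using p(1) by (auto simp: K_def ereal_epigraph_def)
  \<comment> \<open>Values above \<open>M\<close> need no comparison within \<open>K\<close>, since
    the minimal height \<open>t\<close> is at most \<open>M\<close>.\<close>
  have "?G v \<le> ?G u" for u
  proof (cases "?G u \<le> ereal M")
    case True
    moreover have "?G u \<noteq> -\<infinity>"
      using lb[of u] by auto
    ultimately obtain r where r: "?G u = ereal r" "r \<le> M"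
      by (cases "?G u") auto
    then have "(u, r) \<in> K"
      by (auto simp: K_def ereal_epigraph_def)
    then have "t \<le> r"
      using p(2) by fastforce
    then show ?thesis
      using vt r by (metis ereal_less_eq(3) order_trans)
  next
    case False
    then show ?thesis
      using vt by (meson ereal_less_eq(3) linear order_trans)
  qed
  then show ?thesis
    by blast
qed

section \<open>First-order conditions and quadratic upper bounds\<close>

text \<open>Moving from \<open>y\<close> towards \<open>u\<close> by a fraction \<open>t\<close>,
  the convex part stays below its chord, while the error of the quadratic model of \<open>s\<close>
  is of order \<open>t^2\<close>. Dividing by \<open>t\<close> and letting it tend to 0 removes the
  error. In effect \<open>- G\<close> is a subgradient of \<open>g\<close> at
  \<open>y\<close>.\<close>

lemma composite_first_order:
  fixes g :: "'a::real_inner \<Rightarrow> ereal"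
  assumes "convex_fun g"
    and min: "\<And>u. ereal (s y) + g y \<le> ereal (s u) + g u"
    and s: "\<And>d. s (y + d) \<le> s y + G \<bullet> d + C * (norm d)\<^sup>2"
    and y: "g y = ereal a" and u: "g u = ereal c"
  shows "a \<le> c + G \<bullet> (u - y)"
proof -
  define d where "d = u - y"
  have bound: "a - c - G \<bullet> d \<le> t * (C * (norm d)\<^sup>2)" if t: "0 < t" "t < 1" for t
  proof -
    have eq: "(1 - t) *\<^sub>R y + t *\<^sub>R u = y + t *\<^sub>R d"
      by (simp add: d_def algebra_simps)
    have "ereal (s y + a) \<le> ereal (s (y + t *\<^sub>R d)) + g (y + t *\<^sub>R d)"
      using min[of "y + t *\<^sub>R d"] y by simp
    also have "\<dots> \<le> ereal (s (y + t *\<^sub>R d)) + ereal ((1 - t) * a + t * c)"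
      using convex_funD[OF assms(1), of y a u c t] y u t eq by (intro add_left_mono) auto
    finally have "s y + a \<le> s (y + t *\<^sub>R d) + ((1 - t) * a + t * c)"
      by simp
    also have "s (y + t *\<^sub>R d) \<le> s y + t * (G \<bullet> d) + C * (t\<^sup>2 * (norm d)\<^sup>2)"
      using s[of "t *\<^sub>R d"] by (simp add: power_mult_distrib)
    finally have "t * (a - c - G \<bullet> d) \<le> t * (t * (C * (norm d)\<^sup>2))"
      by (simp add: algebra_simps power2_eq_square)
    then show ?thesis
      using t by simp
  qed
  have "((\<lambda>t. t * (C * (norm d)\<^sup>2)) \<longlongrightarrow> 0 * (C * (norm d)\<^sup>2)) (at_right (0::real))"
    by (intro tendsto_intros)
  moreover have "\<forall>\<^sub>F t in at_right (0::real). a - c - G \<bullet> d \<le> t * (C * (norm d)\<^sup>2)"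
    using eventually_at_right_real[OF zero_less_one] by (rule eventually_mono) (simp add: bound)
  ultimately have "a - c - G \<bullet> d \<le> 0"
    by (intro tendsto_lowerbound[of _ 0 "at_right (0::real)"]) auto
  then show ?thesis
    by (simp add: d_def)
qed

text \<open>The difference \<open>\<phi>\<close> between \<open>f\<close> and its quadratic model
  along the segment has nonpositive derivative, by the Lipschitz gradient and
  Cauchy-Schwarz.\<close>

lemma smooth_with_descent:
  fixes f :: "'a::euclidean_space \<Rightarrow> real"
  assumes "smooth_with L f"
  shows "f (x + d) \<le> f x + grad f x \<bullet> d + L / 2 * (norm d)\<^sup>2"
proof -
  define \<phi> where "\<phi> t = f (x + t *\<^sub>R d) - t * (grad f x \<bullet> d) - L / 2 * t\<^sup>2 * (norm d)\<^sup>2" for t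
  have "\<phi> 1 \<le> \<phi> 0"
  proof (rule DERIV_nonpos_imp_nonincreasing[of 0 1 \<phi>])
    fix t :: real assume t: "0 \<le> t" "t \<le> 1"
    have "(f has_derivative (\<lambda>v. v \<bullet> grad f (x + t *\<^sub>R d))) (at (x + t *\<^sub>R d))"
      using GDERIV_grad[of f "x + t *\<^sub>R d"] assms by (simp add: smooth_with_def gderiv_def inner_commute)
    moreover have "((\<lambda>t. x + t *\<^sub>R d) has_derivative (\<lambda>v. v *\<^sub>R d)) (at t)"
      by (auto intro!: derivative_eq_intros)
    ultimately have "((\<lambda>t. f (x + t *\<^sub>R d)) has_derivative (\<lambda>v. (v *\<^sub>R d) \<bullet> grad f (x + t *\<^sub>R d))) (at t)"
      by (rule has_derivative_compose[rotated])
    then have "((\<lambda>t. f (x + t *\<^sub>R d)) has_real_derivative grad f (x + t *\<^sub>R d) \<bullet> d) (at t)"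
      by (simp add: has_field_derivative_def inner_commute mult_commute_abs)
    then have "(\<phi> has_real_derivative
        grad f (x + t *\<^sub>R d) \<bullet> d - grad f x \<bullet> d - L * t * (norm d)\<^sup>2) (at t)"
      unfolding \<phi>_def by (auto intro!: derivative_eq_intros)
    moreover have "(grad f (x + t *\<^sub>R d) - grad f x) \<bullet> d \<le> L * t * (norm d)\<^sup>2"
    proof -
      have "norm (grad f (x + t *\<^sub>R d) - grad f x) \<le> L * (t * norm d)"
        using assms lipschitz_on_normD[of L UNIV "grad f" "x + t *\<^sub>R d" x] t
        by (simp add: smooth_with_def)
      then have "norm (grad f (x + t *\<^sub>R d) - grad f x) * norm d \<le> L * (t * norm d) * norm d"
        by (rule mult_right_mono) simp
      then show ?thesis
        using norm_cauchy_schwarz[of "grad f (x + t *\<^sub>R d) - grad f x" d]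
        by (simp add: power2_eq_square mult.assoc)
    qed
    ultimately show "\<exists>y. (\<phi> has_real_derivative y) (at t) \<and> y \<le> 0"
      by (intro exI conjI) (auto simp: inner_diff_left)
  qed simp
  then show ?thesis
    by (simp add: \<phi>_def)
qed

lemma norm_add_sq: "(norm (y + d - x))\<^sup>2 = (norm (y - x))\<^sup>2 + 2 * ((y - x) \<bullet> d) + (norm d)\<^sup>2"
  for x y d :: "'a::real_inner"
  by (simp add: power2_norm_eq_inner inner_commute algebra_simps)

section \<open>Minimality of the exact step and of the prox point\<close>

text \<open>\<open>exact_step\<close> is a choice operator, so it is known to be a minimizer only
  once one exists. The lower bound \<open>m\<close> leaves the penalty as the coercive term that
  supplies existence.\<close>

lemma exact_step_minimizer:
  fixes f :: "'a::euclidean_space \<Rightarrow> real" and c :: 'a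
  assumes "L > 0" and f: "continuous_on UNIV f"
    and H: "closed_fun H" "proper_fun H"
    and lb: "\<And>u. ereal m \<le> ereal (f u) + H u"
  defines "F \<equiv> \<lambda>u. ereal (f u) + H u"
  defines "y \<equiv> exact_step F L c"
  shows "F y + ereal (L * (norm (y - c))\<^sup>2) \<le> F u + ereal (L * (norm (u - c))\<^sup>2)"
proof -
  have eq: "ereal (f u + L * (norm (u - c))\<^sup>2) + H u = F u + ereal (L * (norm (u - c))\<^sup>2)" for u
    by (cases "H u") (auto simp: F_def)
  have "\<exists>v. \<forall>u. ereal (f v + L * (norm (v - c))\<^sup>2) + H v \<le> ereal (f u + L * (norm (u - c))\<^sup>2) + H u"
  proof (rule coercive_minimizer_exists[OF H _ \<open>L > 0\<close>])
    show "continuous_on UNIV (\<lambda>u. f u + L * (norm (u - c))\<^sup>2)"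
      by (intro continuous_intros f)
    show "ereal (L * (norm (u - c))\<^sup>2 - (- m)) \<le> ereal (f u + L * (norm (u - c))\<^sup>2) + H u" for u
      using lb[of u] by (cases "H u") auto
  qed
  then obtain v where "is_arg_min (\<lambda>x. F x + ereal (L * (norm (x - c))\<^sup>2)) (\<lambda>_. True) v"
    unfolding eq is_arg_min_linorder by blast
  then have "is_arg_min (\<lambda>x. F x + ereal (L * (norm (x - c))\<^sup>2)) (\<lambda>_. True) y"
    unfolding y_def exact_step_def arg_min_def by (rule someI)
  then show ?thesis
    unfolding is_arg_min_linorder by blast
qed

text \<open>Multiplying the prox objective by \<open>2 * L\<close> gives \<open>?Q\<close> without
  moving its minimizers. Coercivity is assumed of the sum because \<open>H\<close> alone carries no
  lower bound here.\<close>

lemma prox_minimizer: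
  fixes H :: "'a::euclidean_space \<Rightarrow> ereal" and z :: 'a
  assumes "L > 0" and H: "closed_fun H" "proper_fun H" and "c > 0"
    and lb: "\<And>u. ereal (c * (norm (u - a))\<^sup>2 - C) \<le> ereal (L * (norm (z - u))\<^sup>2) + H u"
  defines "p \<equiv> prox (\<lambda>u. ereal (1 / (2 * L)) * H u) z"
  shows "ereal (L * (norm (z - p))\<^sup>2) + H p \<le> ereal (L * (norm (z - u))\<^sup>2) + H u"
proof -
  let ?Q = "\<lambda>u. ereal (L * (norm (z - u))\<^sup>2) + H u"
  let ?P = "\<lambda>u. ereal (1 / (2 * L)) * H u + ereal (1 / 2 * (norm (z - u))\<^sup>2)"
  have le_iff: "?P v \<le> ?P u \<longleftrightarrow> ?Q v \<le> ?Q u" for u v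
  proof -
    have "?P w = ereal (1 / (2 * L)) * ?Q w" for w
      using \<open>L > 0\<close> by (cases "H w") (auto simp: field_simps)
    then show ?thesis
      using \<open>L > 0\<close> by (simp add: ereal_mult_le_mult_iff)
  qed
  have "\<exists>v. \<forall>u. ?Q v \<le> ?Q u"
    by (rule coercive_minimizer_exists[OF H _ \<open>c > 0\<close> lb]) (intro continuous_intros)
  then obtain v where "is_arg_min ?P (\<lambda>_. True) v"
    unfolding is_arg_min_linorder le_iff by blast
  then have "is_arg_min ?P (\<lambda>_. True) p"
    unfolding p_def prox_def arg_min_def by (rule someI)
  then show ?thesis
    unfolding is_arg_min_linorder le_iff by blast
qed

lemma finite_if_minimizer:
  fixes H :: "'a \<Rightarrow> ereal"
  assumes "proper_fun H" "\<And>u. ereal (s y) + H y \<le> ereal (s u) + H u"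
  obtains a where "H y = ereal a"
proof -
  obtain u where "H u < \<infinity>"
    using assms(1) by (auto simp: proper_fun_def)
  then have "H y \<noteq> \<infinity>"
    using assms(2)[of u] by auto
  moreover have "H y \<noteq> -\<infinity>"
    using assms(1) by (auto simp: proper_fun_def)
  ultimately show thesis
    using that by (cases "H y") auto
qed

section \<open>Suboptimality bounded by the proximal residual\<close>

text \<open>Both \<open>y\<close> and \<open>p\<close> minimize \<open>H\<close> plus a penalty of
  weight \<open>L\<close> around \<open>x\<close> plus \<open>f\<close> itself for \<open>y\<close>,
  the linearization of \<open>f\<close> at \<open>x\<close> for \<open>p\<close>. Strong
  monotonicity of modulus \<open>2 * L\<close> against an \<open>L\<close>-Lipschitz gradient
  mismatch gives the factor 1/2; the triangle inequality adds 1.\<close>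

lemma subopt_le_exact_step:
  fixes f :: "'a::euclidean_space \<Rightarrow> real" and x :: 'a
  assumes L: "L > 0" and f: "smooth_with L f"
    and H: "closed_fun H" "proper_fun H" "convex_fun H"
    and lb: "\<And>u. ereal m \<le> ereal (f u) + H u"
  defines "y \<equiv> exact_step (\<lambda>u. ereal (f u) + H u) L x"
  defines "p \<equiv> prox (\<lambda>u. ereal (1 / (2 * L)) * H u) (x - (1 / (2 * L)) *\<^sub>R grad f x)"
  shows "norm (x - p) \<le> 3 / 2 * norm (x - y)"
proof -
  define z where "z = x - (1 / (2 * L)) *\<^sub>R grad f x"
  define s where "s u = f u + L * (norm (u - x))\<^sup>2" for u
  define q where "q u = L * (norm (z - u))\<^sup>2" for u
  have cont: "continuous_on UNIV f"
    using f by (auto simp: smooth_with_def continuous_on_eq_continuous_within differentiable_imp_continuous_within)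
  have descent: "f (u + d) \<le> f u + grad f u \<bullet> d + L / 2 * (norm d)\<^sup>2" for u d
    by (rule smooth_with_descent[OF f])
  have y_min: "ereal (s y) + H y \<le> ereal (s u) + H u" for u
    using exact_step_minimizer[OF L cont H(1,2) lb, of x u] unfolding y_def[symmetric] s_def
    by (cases "H y"; cases "H u") auto
  have q_eq: "q (u + d) = q u + (2 * L) *\<^sub>R (u - z) \<bullet> d + L * (norm d)\<^sup>2" for u d
    unfolding q_def norm_minus_commute[of z] norm_add_sq by (simp add: distrib_left)
  \<comment> \<open>The shift in \<open>z\<close> makes \<open>q\<close>, up to a constant, the
    linearization of \<open>f\<close> at \<open>x\<close> plus the penalty that occurs in
    \<open>s\<close>.\<close>
  have grad_z: "(2 * L) *\<^sub>R (u - z) = grad f x + (2 * L) *\<^sub>R (u - x)" for u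
    using L by (simp add: z_def algebra_simps)
  have q_x: "q (x + d) = q x + grad f x \<bullet> d + L * (norm d)\<^sup>2" for d
    using q_eq[of x d] grad_z[of x] by simp
  have p_min: "ereal (q p) + H p \<le> ereal (q u) + H u" for u
    unfolding q_def p_def z_def[symmetric]
  proof (rule prox_minimizer[OF L H(1,2)])
    \<comment> \<open>Since \<open>H u \<ge> m - f u\<close>, the descent bound at \<open>x\<close>
      applies and the linear terms cancel; the growth \<open>L\<close> of \<open>q\<close> less the
      \<open>L / 2\<close> lost to \<open>f\<close> leaves \<open>L / 2\<close>.\<close>
    show "L / 2 > 0"
      using L by simp
    fix u
    have "m - f u + q u \<ge> L / 2 * (norm (u - x))\<^sup>2 - (f x - m - q x)"
      using descent[of x "u - x"] q_x[of "u - x"] by simp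
    then show "ereal (L / 2 * (norm (u - x))\<^sup>2 - (f x - m - q x)) \<le> ereal (L * (norm (z - u))\<^sup>2) + H u"
      using lb[of u] unfolding q_def[of u] by (cases "H u") auto
  qed
  obtain a where a: "H y = ereal a"
    using finite_if_minimizer[OF H(2) y_min] .
  obtain c where c: "H p = ereal c"
    using finite_if_minimizer[OF H(2) p_min] .
  have "a \<le> c + (grad f y + (2 * L) *\<^sub>R (y - x)) \<bullet> (p - y)"
  proof (rule composite_first_order[OF H(3) y_min _ a c])
    \<comment> \<open>The constant is \<open>L / 2\<close> from the descent bound plus
      \<open>L\<close> from the penalty.\<close>
    show "s (y + d) \<le> s y + (grad f y + (2 * L) *\<^sub>R (y - x)) \<bullet> d + (3 / 2 * L) * (norm d)\<^sup>2" for d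
      using descent[of y d] unfolding s_def norm_add_sq by (simp add: inner_add_left distrib_left)
  qed
  moreover have "c \<le> a + (grad f x + (2 * L) *\<^sub>R (p - x)) \<bullet> (y - p)"
    using q_eq grad_z by (intro composite_first_order[OF H(3) p_min _ c a, of _ L]) simp
  \<comment> \<open>Adding the two conditions cancels \<open>a\<close> and \<open>c\<close>; the
    penalty gradients differ by \<open>2 * L\<close> times \<open>y - p\<close>.\<close>
  ultimately have "2 * L * (norm (p - y))\<^sup>2 \<le> (grad f y - grad f x) \<bullet> (p - y)"
    by (simp add: power2_norm_eq_inner inner_add_left inner_diff_left inner_diff_right
        inner_commute algebra_simps)
  also have "\<dots> \<le> norm (grad f y - grad f x) * norm (p - y)"
    by (rule norm_cauchy_schwarz)
  also have "\<dots> \<le> (L * norm (y - x)) * norm (p - y)"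
    using f lipschitz_on_normD[of L UNIV "grad f" y x]
    by (intro mult_right_mono) (auto simp: smooth_with_def)
  finally have "norm (p - y) * (2 * L * norm (p - y)) \<le> norm (p - y) * (L * norm (y - x))"
    by (simp add: power2_eq_square mult_ac)
  \<comment> \<open>At \<open>p = y\<close> no factor can be cancelled, but the bound is trivial
    there.\<close>
  then have "norm (p - y) \<le> norm (y - x) / 2"
    using L by (cases "p = y") (auto simp: field_simps)
  moreover have "norm (x - p) \<le> norm (x - y) + norm (p - y)"
    using norm_triangle_ineq[of "x - y" "y - p"] by (simp add: norm_minus_commute)
  ultimately show ?thesis
    by (simp add: norm_minus_commute)
qed

section \<open>Sums of tolerances and of residuals\<close>

text \<open>The bound is sharpened to \<open>2 - 1 / n\<close> so that the induction telescopes
  through \<open>1 / (n + 1)^2 \<le> 1 / n - 1 / (n + 1)\<close>. Starting at \<open>Suc n\<close>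
  keeps \<open>1 / 0\<close> out of it.\<close>

lemma sum_inverse_squares_le: "(\<Sum>k=1..n. 1 / (real k)\<^sup>2) \<le> 2"
proof -
  have "(\<Sum>k=1..Suc n. 1 / (real k)\<^sup>2) \<le> 2 - 1 / real (Suc n)" for n
  proof (induction n)
    case (Suc n)
    have "1 / (real (Suc (Suc n)))\<^sup>2 \<le> 1 / (real (Suc n) * real (Suc (Suc n)))"
      unfolding power2_eq_square by (intro divide_left_mono mult_right_mono) auto
    also have "\<dots> = 1 / real (Suc n) - 1 / real (Suc (Suc n))"
      by (simp add: field_simps)
    finally have "1 / (real (Suc (Suc n)))\<^sup>2 \<le> 1 / real (Suc n) - 1 / real (Suc (Suc n))" .
    with Suc show ?case
      by simp
  qed simp
  then have "(\<Sum>k=1..Suc n. 1 / (real k)\<^sup>2) \<le> 2" for n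
    by (smt (verit) divide_nonneg_nonneg of_nat_0_le_iff)
  then show ?thesis
    by (cases n) auto
qed

lemma sum_residuals_le:
  fixes f :: "'a::euclidean_space \<Rightarrow> real"
  assumes L: "L > 0" and f: "continuous_on UNIV f"
    and H: "closed_fun H" "proper_fun H"
    and lb: "\<And>u. ereal m \<le> ereal (f u) + H u"
  defines "F \<equiv> \<lambda>u. ereal (f u) + H u"
  assumes "inexact_prox_point F L \<delta> T x"
    and init: "F (exact_step F L (x 0)) \<le> ereal (m + \<Delta>)"
  shows "L * (\<Sum>k=1..T. (norm (x k - exact_step F L (x k)))\<^sup>2) \<le> \<Delta> + L * (\<Sum>k=1..T. (\<delta> k)\<^sup>2)"
proof -
  \<comment> \<open>Here \<open>y k\<close> is the exact step from \<open>x k\<close>, so the index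
    is one less than in the overview and \<open>\<delta> k\<close> bounds the distance from
    \<open>x k\<close> to \<open>y (k - 1)\<close>.\<close>
  define y where "y k = exact_step F L (x k)" for k
  have y_min: "F (y k) + ereal (L * (norm (y k - x k))\<^sup>2) \<le> F u + ereal (L * (norm (u - x k))\<^sup>2)" for k u
    unfolding y_def F_def by (rule exact_step_minimizer[OF L f H lb])
  \<comment> \<open>Finite values at all exact steps permit real subtraction in the telescoping
    sum.\<close>
  have "\<exists>r. F (y k) = ereal r" for k
  proof -
    obtain a where "H (y k) = ereal a"
    proof (rule finite_if_minimizer[OF H(2)])
      show "ereal (f (y k) + L * (norm (y k - x k))\<^sup>2) + H (y k)
          \<le> ereal (f u + L * (norm (u - x k))\<^sup>2) + H u" for u
        using y_min[of k u] unfolding F_def by (cases "H (y k)"; cases "H u") auto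
    qed
    then show ?thesis
      by (simp add: F_def)
  qed
  then obtain r where r: "F (y k) = ereal (r k)" for k
    by metis
  have "L * (norm (x k - y k))\<^sup>2 \<le> r (k - 1) - r k + L * (\<delta> k)\<^sup>2" if k: "k \<in> {1..T}" for k
  proof -
    \<comment> \<open>The previous exact step serves as competitor in the subproblem centred at
      \<open>x k\<close>; this is its penalty.\<close>
    have "(norm (y (k - 1) - x k))\<^sup>2 \<le> (\<delta> k)\<^sup>2"
      using assms(7) k by (intro power_mono) (auto simp: inexact_prox_point_def y_def norm_minus_commute)
    then have "L * (norm (y (k - 1) - x k))\<^sup>2 \<le> L * (\<delta> k)\<^sup>2"
      using L by simp
    then show ?thesis
      using y_min[of k "y (k - 1)"] r by (simp add: norm_minus_commute)
  qed
  then have "(\<Sum>k=1..T. L * (norm (x k - y k))\<^sup>2) \<le> (\<Sum>k=1..T. r (k - 1) - r k + L * (\<delta> k)\<^sup>2)"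
    by (intro sum_mono)
  also have "\<dots> = (\<Sum>k=1..T. r (k - 1) - r k) + L * (\<Sum>k=1..T. (\<delta> k)\<^sup>2)"
    by (simp add: sum.distrib sum_distrib_left)
  also have "(\<Sum>k=1..T. r (k - 1) - r k) = r 0 - r T"
    by (induction T) auto
  \<comment> \<open>\<open>init\<close> bounds \<open>r 0\<close> from above by
    \<open>m + \<Delta>\<close>, and \<open>m\<close> bounds \<open>r T\<close> from below.\<close>
  also have "r 0 - r T \<le> \<Delta>"
    using init lb[of "y T"] r[of T] r[of 0] by (simp add: F_def y_def)
  finally show ?thesis
    by (simp add: y_def sum_distrib_left)
qed

text \<open>Averaging: were every value above the nonnegative root, the squares would sum to more
  than \<open>B\<close>.\<close>

lemma Min_le_if_sum_squares_le:
  fixes g :: "nat \<Rightarrow> real"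
  assumes "T \<ge> 1" "B \<ge> 0" "(\<Sum>k=1..T. (g k)\<^sup>2) \<le> B"
  shows "(MIN k\<in>{1..T}. g k) \<le> sqrt (B / real T)"
proof (rule ccontr)
  assume "\<not> ?thesis"
  then have "sqrt (B / real T) < g k" if "k \<in> {1..T}" for k
    using that assms(1) by (auto simp: not_le)
  then have "(sqrt (B / real T))\<^sup>2 < (g k)\<^sup>2" if "k \<in> {1..T}" for k
    using that assms(2) by (intro power_strict_mono) auto
  then have "(\<Sum>k=1..T. B / real T) < (\<Sum>k=1..T. (g k)\<^sup>2)"
    using assms by (intro sum_strict_mono) auto
  then show False
    using assms by simp
qed

section \<open>The convergence rate under both initial conditions\<close>

theorem theorem2:
  fixes f :: "real ^ 'n \<Rightarrow> real"
    and h :: "real ^ 'm \<Rightarrow> ereal"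
    and A :: "real ^ 'n ^ 'm"
    and b :: "real ^ 'm"
    and L\<^sub>f \<kappa>\<^sub>A :: real
    and x :: "nat \<Rightarrow> real ^ 'n"
    and \<delta> :: "nat \<Rightarrow> real"
    and T :: nat
  defines "F \<equiv> composite_obj f h A b"
  assumes "L\<^sub>f > 0"
    and "smooth_with L\<^sub>f f"
    and "proper_fun h" and "closed_fun h" and "convex_fun h"
    and "rank A = CARD('m)"
    and "condition_number A = \<kappa>\<^sub>A"
    and "T \<ge> 1"
    and "inexact_prox_point F L\<^sub>f \<delta> T x"
  shows "(\<forall>\<Delta>'::real.
            F (exact_step F L\<^sub>f (x 0)) - (INF z. F z) \<le> ereal \<Delta>' \<longrightarrow>
            (\<forall>k\<ge>1. \<delta> k = sqrt (\<Delta>' / L\<^sub>f) / (2 * real k)) \<longrightarrow>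
            (MIN k\<in>{1..T}. subopt_nc L\<^sub>f f h A b (x k)) \<le> sqrt (5 * L\<^sub>f * \<Delta>' / real T)) \<and>
         (\<forall>\<Delta>::real. \<Delta> > 0 \<longrightarrow>
            x 0 \<in> eff_dom F \<longrightarrow>
            F (x 0) - (INF z. F z) \<le> ereal \<Delta> \<longrightarrow>
            (\<forall>k\<ge>1. \<delta> k = sqrt (\<Delta> / L\<^sub>f) / (2 * real k)) \<longrightarrow>
            (MIN k\<in>{1..T}. subopt_nc L\<^sub>f f h A b (x k)) \<le> sqrt (5 * L\<^sub>f * \<Delta> / real T))"
proof -
  let ?H = "\<lambda>u. h (A *v u - b)"
  note [simp] = F_def composite_obj_def
  have F_eq: "F = (\<lambda>u. ereal (f u) + ?H u)"
    by auto
  have H: "closed_fun ?H" "proper_fun ?H" "convex_fun ?H"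
    using assms by (auto intro: closed_fun_affine_compose proper_fun_affine_compose convex_fun_affine_compose)
  have cont: "continuous_on UNIV f"
    using assms(3) by (auto simp: smooth_with_def continuous_on_eq_continuous_within differentiable_imp_continuous_within)
  \<comment> \<open>An infimum of minus infinity would make the gap infinite, against its real
    bound; properness excludes plus infinity.\<close>
  have inf_real: "\<exists>m. (INF z. F z) = ereal m" if "F u - (INF z. F z) \<le> ereal D" for u D
  proof -
    obtain v where v: "F v < \<infinity>"
      using H(2) by (auto simp: proper_fun_def)
    have "(INF z. F z) \<le> F v"
      by (rule INF_lower) simp
    then have "(INF z. F z) \<noteq> \<infinity>"
      using v by auto
    moreover have "(INF z. F z) \<noteq> -\<infinity>"
      using that H(2) by (cases "F u") auto
    ultimately show ?thesis
      by (cases "INF z. F z") auto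
  qed
  have lb: "ereal m \<le> ereal (f u) + ?H u" if "(INF z. F z) = ereal m" for m u
    using INF_lower[of u UNIV F] that by (simp add: F_eq)
  have main: "(MIN k\<in>{1..T}. subopt_nc L\<^sub>f f h A b (x k)) \<le> sqrt (5 * L\<^sub>f * D / real T)"
    if init: "F (exact_step F L\<^sub>f (x 0)) - (INF z. F z) \<le> ereal D"
      and \<delta>: "\<forall>k\<ge>1. \<delta> k = sqrt (D / L\<^sub>f) / (2 * real k)" for D
  proof -
    obtain m where m: "(INF z. F z) = ereal m"
      using inf_real[OF init] by blast
    note lb = lb[OF m]
    let ?y = "\<lambda>k. exact_step F L\<^sub>f (x k)"
    have init': "F (?y 0) \<le> ereal (m + D)"
      using init m by (cases "F (?y 0)") auto
    \<comment> \<open>The sign of \<open>D\<close> comes from the initial gap; it is what makes the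
      square of \<open>sqrt (D / L\<^sub>f)\<close> equal to \<open>D / L\<^sub>f\<close>.\<close>
    have "ereal m \<le> ereal (m + D)"
      using lb[of "?y 0"] init' unfolding F_eq by (rule order_trans)
    then have D: "D \<ge> 0"
      by simp
    \<comment> \<open>The halved root contributes the 4 in the denominator, so inexactness adds at
      most \<open>D / 2\<close> to the initial gap \<open>D\<close>.\<close>
    have "(\<Sum>k=1..T. (\<delta> k)\<^sup>2) = (\<Sum>k=1..T. D / (4 * L\<^sub>f) * (1 / (real k)\<^sup>2))"
      using \<delta> D assms(2) by (intro sum.cong) (auto simp: power_divide power_mult_distrib)
    also have "\<dots> = D / (4 * L\<^sub>f) * (\<Sum>k=1..T. 1 / (real k)\<^sup>2)"
      by (simp add: sum_distrib_left)
    also have "\<dots> \<le> D / (4 * L\<^sub>f) * 2"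
      using D assms(2) by (intro mult_left_mono sum_inverse_squares_le) auto
    finally have "L\<^sub>f * (\<Sum>k=1..T. (\<delta> k)\<^sup>2) \<le> D / 2"
      using assms(2) by (simp add: field_simps)
    moreover have "L\<^sub>f * (\<Sum>k=1..T. (norm (x k - ?y k))\<^sup>2) \<le> D + L\<^sub>f * (\<Sum>k=1..T. (\<delta> k)\<^sup>2)"
      using sum_residuals_le[OF assms(2) cont H(1,2) lb] assms(10) init' unfolding F_eq by blast
    ultimately have residuals: "L\<^sub>f * (\<Sum>k=1..T. (norm (x k - ?y k))\<^sup>2) \<le> 3 / 2 * D"
      by linarith
    have "(\<Sum>k=1..T. (subopt_nc L\<^sub>f f h A b (x k))\<^sup>2)
        \<le> (\<Sum>k=1..T. 9 / 4 * L\<^sub>f * (L\<^sub>f * (norm (x k - ?y k))\<^sup>2))"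
    proof (rule sum_mono)
      fix k
      have "subopt_nc L\<^sub>f f h A b (x k) \<le> L\<^sub>f * (3 / 2 * norm (x k - ?y k))"
        using subopt_le_exact_step[OF assms(2,3) H lb, of "x k"] assms(2)
        unfolding subopt_nc_def F_eq by (intro mult_left_mono) auto
      then have "(subopt_nc L\<^sub>f f h A b (x k))\<^sup>2 \<le> (L\<^sub>f * (3 / 2 * norm (x k - ?y k)))\<^sup>2"
        using assms(2) by (intro power_mono) (auto simp: subopt_nc_def)
      then show "(subopt_nc L\<^sub>f f h A b (x k))\<^sup>2 \<le> 9 / 4 * L\<^sub>f * (L\<^sub>f * (norm (x k - ?y k))\<^sup>2)"
        by (simp add: power_mult_distrib power2_eq_square mult_ac)
    qed
    also have "\<dots> = 9 / 4 * L\<^sub>f * (L\<^sub>f * (\<Sum>k=1..T. (norm (x k - ?y k))\<^sup>2))"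
      by (simp add: sum_distrib_left)
    also have "\<dots> \<le> 9 / 4 * L\<^sub>f * (3 / 2 * D)"
      using assms(2) residuals by (intro mult_left_mono) auto
    \<comment> \<open>The exact factor is 27/8, which leaves slack below 5.\<close>
    also have "\<dots> \<le> 5 * L\<^sub>f * D"
      using assms(2) D by simp
    finally show ?thesis
      using assms(2,9) D by (intro Min_le_if_sum_squares_le) auto
  qed
  \<comment> \<open>The penalty vanishes at its centre \<open>x 0\<close>, so the exact step does
    not increase \<open>F\<close> and inherits the gap bound; this reduces the second claim to the
    first.\<close>
  moreover have "F (exact_step F L\<^sub>f (x 0)) - (INF z. F z) \<le> ereal D"
    if init: "F (x 0) - (INF z. F z) \<le> ereal D" for D
  proof -
    let ?y = "exact_step F L\<^sub>f (x 0)"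
    obtain m where m: "(INF z. F z) = ereal m"
      using inf_real[OF init] by blast
    have "F ?y + ereal (L\<^sub>f * (norm (?y - x 0))\<^sup>2) \<le> F (x 0) + ereal (L\<^sub>f * (norm (x 0 - x 0))\<^sup>2)"
      unfolding F_eq by (rule exact_step_minimizer[OF assms(2) cont H(1,2) lb[OF m]])
    moreover have "F ?y \<le> F ?y + ereal (L\<^sub>f * (norm (?y - x 0))\<^sup>2)"
      using assms(2) by (intro ereal_le_add_self) auto
    ultimately have "F ?y \<le> F (x 0)"
      by (auto simp: zero_ereal_def[symmetric] simp del: F_def)
    then show ?thesis
      using init by (meson ereal_minus_mono order_refl order_trans)
  qed
  ultimately show ?thesis
    by blast
qed

end
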